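(* For every constant $\alpha>0$ there exists a constant $C=C(\alpha)>0$ such that for every positive integer $n$, every $n$-vertex graph $G$ and every edge coloring $\mathcal{F}$ of $G$, if at least $\alpha n$ color classes of $\mathcal{F}$ consist of (the edge set of) a triangle and at least $(1-\alpha)n$ color classes of $\mathcal{F}$ consist of a single edge, then the rainbow girth of $\mathcal{F}$ is at most $C\log n$.
   Context: Graphs are finite and simple. An edge coloring of a graph $G$ is a family $\mathcal{F}=(F_1,\dots,F_m)$ of pairwise disjoint nonempty sets of edges with $\bigcup_{i=1}^m F_i=E(G)$; the indices $i$ are the colors and the sets $F_i$ are the color classes. A set of edges $F$ is rainbow for $\mathcal{F}$ if its edges are taken from distinct $F_i$'s, i.e. $|F\cap F_i|\le 1$ for each $i$. The rainbow girth $rgirth(\mathcal{F})$ is the minimum length of a cycle in $G$ whose edge set is rainbow ($\infty$ if there is none). *)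

theory Defs
  imports Complex_Main "HOL-Library.Extended_Real" "HOL-Library.Disjoint_Sets"
begin

definition simple_graph :: "'a set \<Rightarrow> 'a set set \<Rightarrow> bool" where
  "simple_graph V E \<longleftrightarrow> finite V \<and> (\<forall>e\<in>E. e \<subseteq> V \<and> card e = 2)"

text \<open>The family (F 1, ..., F m); the values of F outside {1..m} play no role.\<close>

definition edge_coloring :: "'a set set \<Rightarrow> nat \<Rightarrow> (nat \<Rightarrow> 'a set set) \<Rightarrow> bool" where
  "edge_coloring E m F \<longleftrightarrow>
     (\<forall>i\<in>{1..m}. F i \<noteq> {}) \<and> disjoint_family_on F {1..m} \<and> (\<Union>i\<in>{1..m}. F i) = E"

definition is_triangle :: "'a set set \<Rightarrow> bool" where
  "is_triangle T \<longleftrightarrow>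
     (\<exists>x y z. x \<noteq> y \<and> y \<noteq> z \<and> x \<noteq> z \<and> T = {{x, y}, {y, z}, {x, z}})"

definition triangle_colors :: "nat \<Rightarrow> (nat \<Rightarrow> 'a set set) \<Rightarrow> nat set" where
  "triangle_colors m F = {i \<in> {1..m}. is_triangle (F i)}"

definition single_edge_colors :: "nat \<Rightarrow> (nat \<Rightarrow> 'a set set) \<Rightarrow> nat set" where
  "single_edge_colors m F = {i \<in> {1..m}. \<exists>e. F i = {e}}"

definition rainbow :: "nat \<Rightarrow> (nat \<Rightarrow> 'a set set) \<Rightarrow> 'a set set \<Rightarrow> bool" where
  "rainbow m F S \<longleftrightarrow> (\<forall>i\<in>{1..m}. card (S \<inter> F i) \<le> 1)"

text \<open>A cycle is given by the list of its vertices in cyclic order, without repeating the first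
  vertex at the end, so the length of the cycle is the length of the list.\<close>

definition cycle_edges :: "'a list \<Rightarrow> 'a set set" where
  "cycle_edges p = {{p ! i, p ! (Suc i mod length p)} |i. i < length p}"

definition is_cycle :: "'a set set \<Rightarrow> 'a list \<Rightarrow> bool" where
  "is_cycle E p \<longleftrightarrow> 3 \<le> length p \<and> distinct p \<and> cycle_edges p \<subseteq> E"

text \<open>The infimum of the empty set in \<^typ>\<open>enat\<close> is infinity.\<close>

definition rgirth :: "'a set set \<Rightarrow> nat \<Rightarrow> (nat \<Rightarrow> 'a set set) \<Rightarrow> enat" where
  "rgirth E m F = (INF p \<in> {p. is_cycle E p \<and> rainbow m F (cycle_edges p)}. enat (length p))"

end

theory Submission
  imports Defs
begin

text \<open>Keep exactly \<open>n\<close> colours: a set \<open>A\<close> of at least \<open>\<alpha>n\<close> triangles and \<open>n - |A|\<close> single edges, the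
  latter forming a graph \<open>H\<close>. A component \<open>C\<close> of \<open>H\<close> has at least \<open>|C| - 1\<close> edges, so counting
  edges shows that at least \<open>|A|\<close> components are trees, and a positive fraction of these have
  bounded size and are touched by boundedly many triangles. If a triangle has two vertices in one small component,
  there is a rainbow cycle of bounded length. Otherwise choose greedily linearly many small tree
  components such that no triangle touches two of them, and delete all their vertices. Each
  deleted tree costs one vertex more than it costs colours, and every triangle retains an edge;
  picking an edge of each surviving colour gives a rainbow graph with at least \<open>1 + \<epsilon>\<close> edges per
  vertex, and such a graph has a cycle of logarithmic length.\<close>

section \<open>Walks, paths and cycles\<close>

text \<open>Adjacency is a relation so that \<open>adj T ^^ k\<close> describes walks of length
  \<open>k\<close> and \<open>(adj T)\<^sup>*\<close> connectedness.\<close>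

definition adj :: "'a set set \<Rightarrow> ('a \<times> 'a) set" where
  "adj T = {(x, y). {x, y} \<in> T}"

lemma adj_mono: "S \<subseteq> T \<Longrightarrow> adj S \<subseteq> adj T"
  by (auto simp: adj_def)

lemma sym_adj: "sym (adj T)"
  by (auto simp: adj_def sym_def insert_commute)

lemma adj_relpow_mono: "S \<subseteq> T \<Longrightarrow> (x, y) \<in> adj S ^^ k \<Longrightarrow> (x, y) \<in> adj T ^^ k"
proof (induction k arbitrary: y)
  case (Suc k)
  then show ?case using adj_mono[OF Suc.prems(1)] by fastforce
qed auto

lemma adj_relpow_sym: "(x, y) \<in> adj T ^^ k \<Longrightarrow> (y, x) \<in> adj T ^^ k"
proof (induction k arbitrary: y)
  case (Suc k)
  then obtain z where "(x, z) \<in> adj T ^^ k" "(z, y) \<in> adj T" by auto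
  then show ?case
    using Suc.IH relpow_Suc_I2 sym_adj[of T] by (metis symD)
qed auto

text \<open>Induction on \<open>k\<close>: if the new endpoint already lies on the path, the path is
  cut off there; otherwise the endpoint is appended.\<close>

lemma path_of_walk:
  assumes "(x, y) \<in> adj T ^^ k"
  shows "\<exists>p. p \<noteq> [] \<and> hd p = x \<and> last p = y \<and> distinct p \<and> length p \<le> Suc k \<and>
    successively (\<lambda>a b. {a, b} \<in> T) p"
  using assms
proof (induction k arbitrary: y)
  case 0
  then show ?case by (intro exI[of _ "[x]"]) auto
next
  case (Suc k)
  then obtain z where "(x, z) \<in> adj T ^^ k" and zy: "{z, y} \<in> T" by (auto simp: adj_def)
  then obtain p where p: "p \<noteq> []" "hd p = x" "last p = z" "distinct p" "length p \<le> Suc k"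
    "successively (\<lambda>a b. {a, b} \<in> T) p" using Suc.IH by blast
  show ?case
  proof (cases "y \<in> set p")
    case True
    then obtain us vs where us: "p = us @ y # vs" by (meson split_list)
    then have "p = (us @ [y]) @ vs" by simp
    then have "successively (\<lambda>a b. {a, b} \<in> T) (us @ [y])"
      using p(6) successively_append_iff by metis
    moreover have "hd (us @ [y]) = x" using us p(2) by (cases us) auto
    ultimately show ?thesis
      using us p by (intro exI[of _ "us @ [y]"]) auto
  next
    case False
    then show ?thesis using p zy
      by (intro exI[of _ "p @ [y]"]) (auto simp: successively_append_iff)
  qed
qed

text \<open>The two degenerate lengths are excluded by the closing pair: on one vertex it would not
  have distinct ends, and on two vertices it would already be an edge of \<open>T\<close>.\<close>

lemma cycle_of_path:
  assumes p: "p \<noteq> []" "distinct p" "successively (\<lambda>a b. {a, b} \<in> T) p"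
    and e: "hd p \<noteq> last p" "{hd p, last p} \<notin> T"
  shows "is_cycle (insert {hd p, last p} T) p"
proof -
  have "length p \<noteq> 1" using e(1) by (auto simp: length_Suc_conv)
  moreover have "length p \<noteq> 2" using e(2) p(3) by (auto simp: length_Suc_conv numeral_2_eq_2)
  ultimately have len: "3 \<le> length p" using p(1) by (cases p; cases "tl p"; force simp: Suc_le_eq)
  have "cycle_edges p \<subseteq> insert {hd p, last p} T"
  proof
    fix f assume "f \<in> cycle_edges p"
    then obtain i where i: "i < length p" "f = {p ! i, p ! (Suc i mod length p)}"
      by (auto simp: cycle_edges_def)
    show "f \<in> insert {hd p, last p} T"
    proof (cases "Suc i < length p")
      case True
      then show ?thesis using i p(3) by (auto simp: successively_conv_nth)
    next
      case False
      then have "Suc i = length p" using i by simp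
      then have "f = {last p, hd p}"
        using i p(1) by (simp add: last_conv_nth hd_conv_nth) (metis diff_Suc_Suc diff_zero)
      then show ?thesis by auto
    qed
  qed
  with len p(2) show ?thesis by (simp add: is_cycle_def)
qed

lemma is_cycle_mono: "is_cycle S p \<Longrightarrow> S \<subseteq> T \<Longrightarrow> is_cycle T p"
  by (auto simp: is_cycle_def)

lemma cycle_of_walk:
  assumes "(x, y) \<in> adj T ^^ k" "x \<noteq> y" "{x, y} \<notin> T"
  shows "\<exists>p. is_cycle (insert {x, y} T) p \<and> length p \<le> Suc k"
  using path_of_walk[OF assms(1)] cycle_of_path assms(2,3) by metis

section \<open>Ball growth and short cycles in dense graphs\<close>

primrec ball :: "'a set set \<Rightarrow> 'a \<Rightarrow> nat \<Rightarrow> 'a set" where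
  "ball E v 0 = {v}"
| "ball E v (Suc r) = ball E v r \<union> adj E `` ball E v r"

lemma ball_self: "v \<in> ball E v r"
  by (induction r) auto

lemma ball_subset: "\<lbrakk>v \<in> V; \<And>e. e \<in> E \<Longrightarrow> e \<subseteq> V\<rbrakk> \<Longrightarrow> ball E v r \<subseteq> V"
  by (induction r) (auto simp: adj_def)

text \<open>Breadth-first search: each vertex of a new sphere contributes one edge, to a parent in
  the previous ball. The root contributes none, so there are fewer edges than vertices. The same
  \<open>T\<close> serves all radii up to \<open>r\<close>, which lets the two ends of an edge be
  bounded by different radii.\<close>

lemma bfs_tree:
  assumes "finite V" "v \<in> V" "\<And>e. e \<in> E \<Longrightarrow> e \<subseteq> V"
  shows "\<exists>T\<subseteq>E. finite T \<and> card T < card (ball E v r) \<and>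
    (\<forall>s\<le>r. \<forall>y\<in>ball E v s. \<exists>k\<le>s. (v, y) \<in> adj T ^^ k)"
proof (induction r)
  case 0
  show ?case by (intro exI[of _ "{}"]) auto
next
  case (Suc r)
  then obtain T where T: "T \<subseteq> E" "finite T" "card T < card (ball E v r)"
    "\<And>s y. s \<le> r \<Longrightarrow> y \<in> ball E v s \<Longrightarrow> \<exists>k\<le>s. (v, y) \<in> adj T ^^ k" by blast
  define N where "N = ball E v (Suc r) - ball E v r"
  have fin: "finite (ball E v s)" for s
    by (rule finite_subset[OF ball_subset[OF assms(2,3)] assms(1)])
  have "\<forall>y\<in>N. \<exists>x. x \<in> ball E v r \<and> {x, y} \<in> E" by (auto simp: N_def adj_def)
  then obtain f where f: "\<And>y. y \<in> N \<Longrightarrow> f y \<in> ball E v r \<and> {f y, y} \<in> E" by metis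
  define T' where "T' = T \<union> (\<lambda>y. {f y, y}) ` N"
  have finN: "finite N" unfolding N_def using fin by (rule finite_Diff)
  have "card T' \<le> card T + card N"
    unfolding T'_def by (meson add_left_mono card_Un_le card_image_le finN le_trans)
  moreover have "card (ball E v (Suc r)) = card (ball E v r) + card N"
    unfolding N_def using card_Diff_subset[OF fin, of r "ball E v (Suc r)"] card_mono[OF fin, of "ball E v r" "Suc r"]
    by (metis Un_upper1 ball.simps(2) le_add_diff_inverse)
  moreover have old: "\<exists>k\<le>s. (v, y) \<in> adj T' ^^ k" if "s \<le> r" "y \<in> ball E v s" for s y
    using T(4)[OF that] adj_relpow_mono[of T T'] unfolding T'_def by blast
  moreover have "\<exists>k\<le>Suc r. (v, y) \<in> adj T' ^^ k" if "y \<in> ball E v (Suc r)" for y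
  proof (cases "y \<in> N")
    case True
    obtain k where "k \<le> r" "(v, f y) \<in> adj T' ^^ k" using old[OF order_refl] f[OF True] by blast
    moreover have "(f y, y) \<in> adj T'" using True by (auto simp: adj_def T'_def)
    ultimately show ?thesis by (intro exI[of _ "Suc k"]) auto
  next
    case False
    then have "y \<in> ball E v r" using that by (auto simp: N_def)
    with old[OF order_refl] show ?thesis using le_SucI by blast
  qed
  ultimately show ?case
    using T f finN by (intro exI[of _ T']) (auto simp: T'_def le_Suc_eq simp del: ball.simps)
qed

text \<open>An edge touching the ball of radius \<open>r\<close> but missing from the search tree of
  radius \<open>Suc r\<close> would close a short cycle. Hence all these edges belong to the tree,
  which has fewer edges than the larger ball has vertices.\<close>

lemma ball_growth:
  assumes "finite V" "v \<in> V" "\<And>e. e \<in> E \<Longrightarrow> e \<subseteq> V \<and> card e = 2"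
    and nc: "\<And>p. is_cycle E p \<Longrightarrow> length p > 2 * Suc r"
  shows "card {e \<in> E. e \<inter> ball E v r \<noteq> {}} < card (ball E v (Suc r))"
proof -
  obtain T where T: "T \<subseteq> E" "finite T" "card T < card (ball E v (Suc r))"
    and walk: "\<And>s y. s \<le> Suc r \<Longrightarrow> y \<in> ball E v s \<Longrightarrow> \<exists>k\<le>s. (v, y) \<in> adj T ^^ k"
    using bfs_tree[OF assms(1,2), of E "Suc r"] assms(3) by blast
  have "{e \<in> E. e \<inter> ball E v r \<noteq> {}} \<subseteq> T"
  proof (safe, rule ccontr)
    fix e x assume e: "e \<in> E" "x \<in> e" "x \<in> ball E v r" "e \<notin> T"
    obtain y where y: "e = {x, y}" "x \<noteq> y"
      using assms(3)[OF e(1)] e(2) by (auto simp: card_2_iff)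
    then have "y \<in> ball E v (Suc r)" using e by (auto simp: adj_def)
    then obtain k where k: "k \<le> Suc r" "(v, y) \<in> adj T ^^ k" using walk[OF order_refl] by blast
    \<comment> \<open>One end is within distance \<open>r\<close> and the other within
      \<open>Suc r\<close>; with the edge itself the cycle has length at most
      \<open>2 * Suc r\<close>.\<close>
    obtain l where l: "l \<le> r" "(v, x) \<in> adj T ^^ l" using walk[of r] e(3) by auto
    have "(x, y) \<in> adj T ^^ (l + k)"
      using adj_relpow_sym[OF l(2)] k(2) by (auto simp: relpow_add)
    then obtain p where p: "is_cycle (insert {x, y} T) p" "length p \<le> Suc (l + k)"
      using cycle_of_walk y e(4) by metis
    have "is_cycle E p" using p(1) is_cycle_mono T(1) e(1) y(1) by (metis insert_subset)
    with nc p(2) k l show False by fastforce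
  qed
  from card_mono[OF T(2) this] T(3) show ?thesis by linarith
qed

text \<open>In a smallest nonempty vertex set spanning at least \<open>1 + \<epsilon>\<close> edges per vertex, every
  nonempty subset \<open>X\<close> meets at least \<open>(1 + \<epsilon>) |X|\<close> of the spanned edges; applied to balls,
  this forces exponential growth as long as the balls are trees.\<close>

lemma dense_short_cycle:
  fixes \<epsilon> :: real
  assumes V: "finite V" "V \<noteq> {}" and E: "\<And>e. e \<in> E \<Longrightarrow> e \<subseteq> V \<and> card e = 2"
    and dense: "(1 + \<epsilon>) * card V \<le> card E" and R: "(1 + \<epsilon>) ^ R > card V" and "\<epsilon> > 0"
  shows "\<exists>p. is_cycle E p \<and> length p \<le> 2 * R"
proof (rule ccontr)
  assume "\<not> ?thesis"
  then have nc: "\<And>p. is_cycle E p \<Longrightarrow> length p > 2 * R" by force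
  define Q where "Q W \<longleftrightarrow> W \<subseteq> V \<and> W \<noteq> {} \<and> (1 + \<epsilon>) * card W \<le> card {e \<in> E. e \<subseteq> W}" for W
  have "{e \<in> E. e \<subseteq> V} = E" using E by blast
  then have "Q V" using V dense by (simp add: Q_def)
  then obtain W where W: "Q W" "\<And>X. Q X \<Longrightarrow> card W \<le> card X"
    using ex_has_least_nat[of Q V card] by blast
  define D where "D = {e \<in> E. e \<subseteq> W}"
  have W': "W \<subseteq> V" "W \<noteq> {}" "(1 + \<epsilon>) * card W \<le> card D" "finite W"
    using W(1) V finite_subset by (auto simp: Q_def D_def)
  have "finite E" using E V(1) by (meson PowI finite_Pow_iff finite_subset subsetI)
  then have finD: "finite D" by (simp add: D_def)
  have touch: "(1 + \<epsilon>) * card X \<le> card {e \<in> D. e \<inter> X \<noteq> {}}" if X: "X \<subseteq> W" "X \<noteq> {}" for X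
  proof (cases "X = W")
    case True
    \<comment> \<open>Here \<open>W - X\<close> is empty and minimality gives nothing, but every
      edge of \<open>D\<close> is a nonempty subset of \<open>W\<close> and so meets it.\<close>
    have "{e \<in> D. e \<inter> W \<noteq> {}} = D"
    proof (intro equalityI subsetI)
      fix e assume "e \<in> D"
      moreover from this have "e \<noteq> {}" using E[of e] by (auto simp: D_def)
      ultimately show "e \<in> {e \<in> D. e \<inter> W \<noteq> {}}" by (auto simp: D_def)
    qed auto
    with True W'(3) show ?thesis by simp
  next
    case False
    have "finite X" using X W' finite_subset by blast
    have "card (W - X) < card W"
      using X W'(4) by (intro psubset_card_mono) auto
    \<comment> \<open>By minimality \<open>W - X\<close> spans too few edges; since \<open>W\<close>
      spans enough, the difference, which consists of edges meeting \<open>X\<close>, must be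
      large.\<close>
    then have "\<not> Q (W - X)" using W(2) by fastforce
    then have 1: "card {e \<in> E. e \<subseteq> W - X} < (1 + \<epsilon>) * card (W - X)"
      using False X W'(1) by (auto simp: Q_def)
    have "card D \<le> card ({e \<in> E. e \<subseteq> W - X} \<union> {e \<in> D. e \<inter> X \<noteq> {}})"
      using \<open>finite E\<close> finD by (intro card_mono) (auto simp: D_def)
    also have "\<dots> \<le> card {e \<in> E. e \<subseteq> W - X} + card {e \<in> D. e \<inter> X \<noteq> {}}"
      by (rule card_Un_le)
    finally have "card D \<le> card {e \<in> E. e \<subseteq> W - X} + card {e \<in> D. e \<inter> X \<noteq> {}}" .
    moreover have "card W = card (W - X) + card X"
      using X \<open>finite X\<close> W'(4) by (metis card_Diff_subset card_mono le_add_diff_inverse2)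
    ultimately show ?thesis using 1 W'(3) by (simp add: algebra_simps)
  qed
  obtain v where v: "v \<in> W" using W' by blast
  have sub: "ball D v r \<subseteq> W" for r by (rule ball_subset[OF v]) (auto simp: D_def)
  have "r \<le> R \<Longrightarrow> (1 + \<epsilon>) ^ r \<le> card (ball D v r)" for r
  proof (induction r)
    case (Suc r)
    have "card {e \<in> D. e \<inter> ball D v r \<noteq> {}} < card (ball D v (Suc r))"
    proof (rule ball_growth[OF W'(4) v])
      show "e \<subseteq> W \<and> card e = 2" if "e \<in> D" for e using that E by (auto simp: D_def)
      show "2 * Suc r < length p" if "is_cycle D p" for p
      proof -
        have "is_cycle E p" by (rule is_cycle_mono[OF that]) (auto simp: D_def)
        with nc Suc.prems show ?thesis by fastforce
      qed
    qed
    moreover have "(1 + \<epsilon>) * card (ball D v r) \<le> card {e \<in> D. e \<inter> ball D v r \<noteq> {}}"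
      using touch[OF sub, of r] ball_self[of v D r] by blast
    moreover have "(1 + \<epsilon>) ^ Suc r \<le> (1 + \<epsilon>) * card (ball D v r)"
      using Suc \<open>\<epsilon> > 0\<close> by simp
    ultimately show ?case by linarith
  qed simp
  from this[of R] have "(1 + \<epsilon>) ^ R \<le> card (ball D v R)" by simp
  also have "card (ball D v R) \<le> card V" using sub W'(1) V(1) by (meson card_mono order_trans)
  finally show False using R by simp
qed

section \<open>Connected components and cycles inside them\<close>

text \<open>Starting from singletons, edges are inserted one at a time: an edge inside a part leaves
  the partition alone, an edge between two parts merges them. The last conjunct says that a
  connected graph has at least as many edges as a spanning tree.\<close>

lemma component_partition:
  assumes "finite V" "finite E" "\<forall>e\<in>E. e \<subseteq> V \<and> card e = 2"
  shows "\<exists>P. partition_on V P \<and> (\<forall>e\<in>E. \<exists>C\<in>P. e \<subseteq> C) \<and>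
    (\<forall>C\<in>P. C \<times> C \<subseteq> (adj E)\<^sup>*) \<and> (\<forall>C\<in>P. card C \<le> Suc (card {e \<in> E. e \<subseteq> C}))"
  using assms(2,3)
proof (induction E rule: finite_induct)
  case empty
  show ?case
    by (intro exI[of _ "(\<lambda>x. {x}) ` V"]) (auto simp: partition_on_def disjoint_def)
next
  case (insert e E)
  have "\<exists>P. partition_on V P \<and> (\<forall>e\<in>E. \<exists>C\<in>P. e \<subseteq> C) \<and>
    (\<forall>C\<in>P. C \<times> C \<subseteq> (adj E)\<^sup>*) \<and> (\<forall>C\<in>P. card C \<le> Suc (card {e \<in> E. e \<subseteq> C}))"
    by (rule insert.IH) (simp add: insert.prems)
  then obtain P where P: "partition_on V P" "\<And>f. f \<in> E \<Longrightarrow> \<exists>C\<in>P. f \<subseteq> C"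
    "\<And>C. C \<in> P \<Longrightarrow> C \<times> C \<subseteq> (adj E)\<^sup>*" "\<And>C. C \<in> P \<Longrightarrow> card C \<le> Suc (card {e \<in> E. e \<subseteq> C})"
    by (elim exE conjE) (rule that, assumption, (erule (1) bspec)+)
  obtain x y where e: "e = {x, y}" "x \<noteq> y" "x \<in> V" "y \<in> V"
    using insert.prems by (auto simp: card_2_iff)
  have mono: "(adj E)\<^sup>* \<subseteq> (adj (insert e E))\<^sup>*" by (intro rtrancl_mono adj_mono) auto
  have mono': "card {f \<in> E. f \<subseteq> C} \<le> card {f \<in> insert e E. f \<subseteq> C}" for C
    using insert.hyps by (intro card_mono) auto
  obtain X Y where XY: "X \<in> P" "x \<in> X" "Y \<in> P" "y \<in> Y"
    using e P(1) by (metis UnionE partition_onD1)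
  show ?case
  proof (cases "X = Y")
    case True
    then have "\<forall>f\<in>insert e E. \<exists>C\<in>P. f \<subseteq> C" using P(2) XY e by blast
    moreover have "\<forall>C\<in>P. C \<times> C \<subseteq> (adj (insert e E))\<^sup>*" using P(3) mono by blast
    moreover have "\<forall>C\<in>P. card C \<le> Suc (card {f \<in> insert e E. f \<subseteq> C})"
      using P(4) mono' by (meson Suc_le_mono le_trans)
    ultimately show ?thesis using P(1) by blast
  next
    case False
    define P' where "P' = insert (X \<union> Y) (P - {X, Y})"
    have disj: "X \<inter> Y = {}" using False XY P(1) by (meson disjointD partition_onD2)
    have finXY: "finite X" "finite Y"
      using XY P(1) assms(1) by (metis Sup_upper finite_subset partition_onD1)+
    have p1: "partition_on V P'"
    proof -
      have "\<Union>P' = \<Union>P" using XY by (auto simp: P'_def)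
      moreover have "disjoint P'"
        using P(1) XY unfolding partition_on_def disjoint_def P'_def by blast
      moreover have "{} \<notin> P'" using P(1) XY by (auto simp: P'_def partition_on_def)
      ultimately show ?thesis using P(1) by (auto simp: partition_on_def)
    qed
    have p2: "\<forall>f\<in>insert e E. \<exists>C\<in>P'. f \<subseteq> C"
    proof
      fix f assume "f \<in> insert e E"
      then consider "f = e" | "f \<in> E" by blast
      then show "\<exists>C\<in>P'. f \<subseteq> C"
      proof cases
        case 1
        then show ?thesis using e XY by (auto simp: P'_def)
      next
        case 2
        then obtain C where "C \<in> P" "f \<subseteq> C" using P(2) by blast
        then show ?thesis by (cases "C \<in> {X, Y}") (auto simp: P'_def)
      qed
    qed
    let ?R = "(adj (insert e E))\<^sup>*"
    have step: "(x, y) \<in> ?R" "(y, x) \<in> ?R"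
      using e by (auto simp: adj_def insert_commute)
    have "(u, x) \<in> ?R \<and> (x, u) \<in> ?R" if "u \<in> X \<union> Y" for u
    proof (cases "u \<in> X")
      case True
      then show ?thesis using P(3)[OF XY(1)] XY(2) mono by blast
    next
      case False
      then have "(u, y) \<in> ?R" "(y, u) \<in> ?R" using that P(3)[OF XY(3)] XY(4) mono by blast+
      with step show ?thesis by (meson rtrancl_trans)
    qed
    then have "(X \<union> Y) \<times> (X \<union> Y) \<subseteq> ?R" by (auto intro: rtrancl_trans)
    then have p3: "\<forall>C\<in>P'. C \<times> C \<subseteq> ?R" using P(3) mono unfolding P'_def by blast
    have "card (X \<union> Y) \<le> Suc (card {f \<in> insert e E. f \<subseteq> X \<union> Y})"
    proof -
      let ?A = "{f \<in> E. f \<subseteq> X}" and ?B = "{f \<in> E. f \<subseteq> Y}"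
      \<comment> \<open>An edge inside both of the disjoint sets \<open>X\<close> and
        \<open>Y\<close> would be empty, so no edge is counted twice.\<close>
      have "{} \<notin> E" using insert.prems by force
      then have "card (?A \<union> ?B) = card ?A + card ?B"
        using disj insert.hyps(1) by (intro card_Un_disjoint) (auto, metis le_inf_iff subset_empty)
      \<comment> \<open>The new edge accounts for one of the two extra units in the bounds for
        \<open>X\<close> and \<open>Y\<close>.\<close>
      then have "card (insert e (?A \<union> ?B)) = Suc (card ?A + card ?B)"
        using insert.hyps by simp
      moreover have "card (insert e (?A \<union> ?B)) \<le> card {f \<in> insert e E. f \<subseteq> X \<union> Y}"
        using insert.hyps e XY by (intro card_mono) auto
      moreover have "card (X \<union> Y) = card X + card Y"
        using disj finXY by (simp add: card_Un_disjoint)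
      ultimately show ?thesis using P(4)[OF XY(1)] P(4)[OF XY(3)] by linarith
    qed
    moreover have "card C \<le> Suc (card {f \<in> insert e E. f \<subseteq> C})" if "C \<in> P" for C
      using P(4)[OF that] mono'[of C] by linarith
    ultimately have "\<forall>C\<in>P'. card C \<le> Suc (card {f \<in> insert e E. f \<subseteq> C})"
      unfolding P'_def by blast
    with p1 p2 p3 show ?thesis by blast
  qed
qed

lemma path_in_component:
  assumes "successively (\<lambda>a b. {a, b} \<in> E) p" "p \<noteq> []" "hd p \<in> C"
    and "\<And>e. e \<in> E \<Longrightarrow> e \<inter> C \<noteq> {} \<Longrightarrow> e \<subseteq> C"
  shows "set p \<subseteq> C"
  using assms(1-3)
proof (induction p)
  case (Cons a p)
  show ?case
  proof (cases p)
    case (Cons b q)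
    with Cons.prems have "{a, b} \<in> E" "a \<in> C" by auto
    then have "b \<in> C" using assms(4)[of "{a, b}"] by auto
    with Cons Cons.IH Cons.prems show ?thesis by auto
  qed (use Cons.prems in auto)
qed simp

text \<open>A path starting in \<open>C\<close> cannot leave it, as \<open>C\<close> is closed under
  the edges of \<open>E\<close>; its distinct vertices therefore number at most
  \<open>card C\<close>.\<close>

lemma cycle_in_component:
  assumes "finite C" "x \<in> C" "(x, y) \<in> (adj E)\<^sup>*" "x \<noteq> y" "{x, y} \<notin> E"
    and "\<And>e. e \<in> E \<Longrightarrow> e \<inter> C \<noteq> {} \<Longrightarrow> e \<subseteq> C"
  shows "\<exists>p. is_cycle (insert {x, y} E) p \<and> length p \<le> card C"
proof -
  obtain k where "(x, y) \<in> adj E ^^ k" using assms(3) rtrancl_imp_relpow by blast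
  then obtain p where p: "p \<noteq> []" "hd p = x" "last p = y" "distinct p"
    "successively (\<lambda>a b. {a, b} \<in> E) p" using path_of_walk by metis
  have "set p \<subseteq> C" using path_in_component[OF p(5,1)] p(2) assms(2,6) by blast
  then have "length p \<le> card C" using p(4) assms(1) by (metis card_mono distinct_card)
  with cycle_of_path[OF p(1,4,5)] p(2,3) assms(4,5) show ?thesis by metis
qed

lemma partition_on_card_Union:
  assumes "finite V" "partition_on V P" "S \<subseteq> P"
  shows "card (\<Union>S) = sum card S"
proof (rule card_Union_disjoint)
  show "disjoint S"
    using assms(2,3) by (meson partition_onD2 pairwise_subset)
  show "finite C" if "C \<in> S" for C
    using that assms by (metis Sup_upper finite_subset partition_onD1 subsetD)
qed

text \<open>Choosing a point of \<open>U\<close> in each part that it meets is injective because the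
  parts are disjoint.\<close>

lemma card_meeting_parts_le:
  assumes "partition_on V P" "finite U"
  shows "card {C \<in> P. U \<inter> C \<noteq> {}} \<le> card U"
proof -
  define h where "h C = (SOME x. x \<in> U \<inter> C)" for C
  have h: "h C \<in> U \<inter> C" if "U \<inter> C \<noteq> {}" for C
    unfolding h_def by (rule someI_ex) (use that in blast)
  have "inj_on h {C \<in> P. U \<inter> C \<noteq> {}}"
  proof (rule inj_onI)
    fix C D assume "C \<in> {C \<in> P. U \<inter> C \<noteq> {}}" "D \<in> {C \<in> P. U \<inter> C \<noteq> {}}" and eq: "h C = h D"
    then have CD: "C \<in> P" "D \<in> P" "U \<inter> C \<noteq> {}" "U \<inter> D \<noteq> {}" by auto
    with eq have "h C \<in> C \<inter> D" using h by (metis IntD2 IntI)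
    then show "C = D" using CD(1,2) partition_onD2[OF assms(1)] by (metis disjointD empty_iff)
  qed
  then show ?thesis using h assms(2) by (intro card_inj_on_le[of h]) auto
qed

section \<open>Independent selection and rainbow choices\<close>

text \<open>Take \<open>S\<close> of maximum size. Every element of \<open>X\<close> outside
  \<open>S\<close> then shares some \<open>N i\<close> with an element of \<open>S\<close>, and each
  element of \<open>S\<close> accounts for at most \<open>d * c\<close> others in this way. With
  components for \<open>X\<close> and triangles for \<open>I\<close>, no triangle touches two chosen
  components.\<close>

lemma independent_family:
  fixes N :: "'i \<Rightarrow> 'c set"
  assumes X: "finite X" and I: "finite I"
    and N: "\<And>i. i \<in> I \<Longrightarrow> finite (N i) \<and> card (N i) \<le> c"
    and d: "\<And>x. x \<in> X \<Longrightarrow> card {i \<in> I. x \<in> N i} \<le> d"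
  shows "\<exists>S\<subseteq>X. (\<forall>i\<in>I. card (N i \<inter> S) \<le> 1) \<and> card X \<le> (1 + d * c) * card S"
proof -
  let ?Q = "\<lambda>S. S \<subseteq> X \<and> (\<forall>i\<in>I. card (N i \<inter> S) \<le> 1)"
  have "?Q {}" by simp
  moreover have "\<forall>S. ?Q S \<longrightarrow> card S < Suc (card X)"
    using X by (auto simp: less_Suc_eq_le intro: card_mono)
  ultimately have "\<exists>S. ?Q S \<and> (\<forall>S'. ?Q S' \<longrightarrow> card S' \<le> card S)"
    by (rule ex_has_greatest_nat)
  then obtain S where S: "?Q S" "\<And>S'. ?Q S' \<Longrightarrow> card S' \<le> card S"
    by (elim exE) (erule conjE, rule that, assumption, erule allE, erule (1) mp)
  have finS: "finite S" using S X finite_subset by blast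
  let ?B = "\<lambda>s. \<Union>i\<in>{i \<in> I. s \<in> N i}. N i"
  have "X \<subseteq> S \<union> (\<Union>s\<in>S. ?B s)"
  proof
    fix x assume x: "x \<in> X"
    show "x \<in> S \<union> (\<Union>s\<in>S. ?B s)"
    proof (cases "x \<in> S")
      case False
      then have "card (insert x S) > card S" using finS by simp
      then have "\<not> ?Q (insert x S)" using S(2) by (meson leD)
      then obtain i where i: "i \<in> I" "card (N i \<inter> insert x S) > 1" using x S(1) by auto
      have "card (N i \<inter> S) \<le> 1" using S(1) i(1) by blast
      then have xN: "x \<in> N i" using i(2) by (metis Int_insert_right_if0 leD)
      have "N i \<inter> S \<noteq> {}" using i(2) xN by auto
      then show ?thesis using i(1) xN by blast
    qed simp
  qed
  moreover have "finite (\<Union>s\<in>S. ?B s)" using finS I N by auto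
  ultimately have "card X \<le> card S + card (\<Union>s\<in>S. ?B s)"
    using finS by (meson card_Un_le card_mono finite_UnI le_trans)
  moreover have "card (\<Union>s\<in>S. ?B s) \<le> (\<Sum>s\<in>S. card (?B s))" using finS by (rule card_UN_le)
  moreover have "(\<Sum>s\<in>S. card (?B s)) \<le> (\<Sum>s\<in>S. d * c)"
  proof (rule sum_mono)
    fix s assume s: "s \<in> S"
    have "card (?B s) \<le> (\<Sum>i\<in>{i \<in> I. s \<in> N i}. card (N i))" using I by (intro card_UN_le) auto
    also have "\<dots> \<le> (\<Sum>i\<in>{i \<in> I. s \<in> N i}. c)" using N by (intro sum_mono) auto
    also have "\<dots> \<le> d * c" using d s S(1) by (simp add: subset_iff)
    finally show "card (?B s) \<le> d * c" .
  qed
  ultimately show ?thesis using S(1) by (intro exI[of _ S]) (auto simp: algebra_simps)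
qed

lemma choice_inj_on:
  assumes "disjoint_family_on F I" "J \<subseteq> I" "\<And>j. j \<in> J \<Longrightarrow> g j \<in> F j"
  shows "inj_on g J"
  using assms unfolding disjoint_family_on_def inj_on_def by (metis disjoint_iff subsetD)

text \<open>Rainbowness is always obtained in this way: the cycle lives in a graph made of one
  chosen edge per color.\<close>

lemma rainbow_choice:
  assumes "disjoint_family_on F {1..m}" "J \<subseteq> {1..m}" "\<And>j. j \<in> J \<Longrightarrow> g j \<in> F j" "S \<subseteq> g ` J"
  shows "rainbow m F S"
  unfolding rainbow_def
proof
  fix i assume i: "i \<in> {1..m}"
  have "S \<inter> F i \<subseteq> {g i}"
  proof
    fix e assume e: "e \<in> S \<inter> F i"
    then obtain j where "j \<in> J" "e = g j" using assms(4) by blast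
    then have "j = i"
      using assms(1-3) e i unfolding disjoint_family_on_def by (metis IntD2 disjoint_iff subsetD)
    with \<open>e = g j\<close> show "e \<in> {g i}" by simp
  qed
  then show "card (S \<inter> F i) \<le> 1" using card_mono[of "{g i}"] by fastforce
qed

section \<open>Existence of a short rainbow cycle\<close>

text \<open>\<open>K\<close> is the size limit for small components and bounds cycles closed inside
  one of them; \<open>2 * R\<close> bounds the cycle found after deleting trees. The constant 148 is
  4 * 37: at least a quarter of \<open>card A\<close> trees are small and rarely touched, and one in
  37 of those is selected.\<close>

lemma rainbow_short_cycle:
  fixes \<alpha> :: real and V :: "'a set"
  assumes \<alpha>: "0 < \<alpha>" "\<alpha> \<le> 1" and V: "simple_graph V E" "V \<noteq> {}" and col: "edge_coloring E m F"
    and tri: "\<alpha> * card V \<le> card (triangle_colors m F)"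
    and total: "card V \<le> card (triangle_colors m F) + card (single_edge_colors m F)"
    and K: "2 / \<alpha> \<le> real K" and R: "(1 + \<alpha> / 148) ^ R > card V"
  shows "\<exists>p. is_cycle E p \<and> rainbow m F (cycle_edges p) \<and> length p \<le> max K (2 * R)"
proof (rule ccontr)
  assume "\<not> ?thesis"
  then have nc: "\<And>p. is_cycle E p \<Longrightarrow> rainbow m F (cycle_edges p) \<Longrightarrow> length p > max K (2 * R)"
    by (meson leI)
  have finV: "finite V" and E: "\<And>e. e \<in> E \<Longrightarrow> e \<subseteq> V \<and> card e = 2"
    using V by (auto simp: simple_graph_def)
  have F: "disjoint_family_on F {1..m}" "\<And>i. i \<in> {1..m} \<Longrightarrow> F i \<subseteq> E"
    using col by (auto simp: edge_coloring_def)
  define n where "n = card V"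
  have n0: "n > 0" using finV V(2) by (simp add: n_def card_gt_0_iff)
  \<comment> \<open>Surplus colors are dropped so that exactly \<open>n\<close> remain, which makes
    the later edge counts exact. With \<open>n\<close> or more triangles, \<open>B\<close> is
    empty.\<close>
  obtain A B where A: "A \<subseteq> triangle_colors m F" and B: "B \<subseteq> single_edge_colors m F"
    and AB: "card A + card B = n" and cA: "\<alpha> * n \<le> card A"
  proof (cases "n \<le> card (triangle_colors m F)")
    case True
    then obtain A where "A \<subseteq> triangle_colors m F" "card A = n"
      by (metis obtain_subset_with_card_n)
    moreover from \<alpha> have "\<alpha> * n \<le> n" by (simp add: mult_left_le_one_le)
    ultimately show ?thesis using that[of A "{}"] by simp
  next
    case False
    then obtain B where "B \<subseteq> single_edge_colors m F" "card B = n - card (triangle_colors m F)"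
      using total by (metis obtain_subset_with_card_n n_def le_diff_conv add.commute)
    with False tri show ?thesis using that[of "triangle_colors m F" B] by (simp add: n_def)
  qed
  have finAB: "finite A" "finite B" and ABm: "A \<subseteq> {1..m}" "B \<subseteq> {1..m}"
  proof -
    show "A \<subseteq> {1..m}" "B \<subseteq> {1..m}"
      using A B by (auto simp: triangle_colors_def single_edge_colors_def)
    then show "finite A" "finite B" using finite_subset by blast+
  qed
  have "\<forall>j\<in>B. \<exists>e. F j = {e}" using B by (auto simp: single_edge_colors_def)
  then obtain g where g: "\<And>j. j \<in> B \<Longrightarrow> F j = {g j}" by metis
  have disjAB: "A \<inter> B = {}"
  proof (rule ccontr)
    assume "A \<inter> B \<noteq> {}"
    then obtain i where i: "i \<in> A" "i \<in> B" by blast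
    then have "is_triangle (F i)" using A by (auto simp: triangle_colors_def)
    with g[OF i(2)] obtain x y z where "x \<noteq> y" "y \<noteq> z" "x \<noteq> z" "{g i} = {{x, y}, {y, z}, {x, z}}"
      by (auto simp: is_triangle_def)
    then have "{x, y} = {y, z}" by blast
    with \<open>x \<noteq> y\<close> \<open>x \<noteq> z\<close> show False by (auto simp: doubleton_eq_iff)
  qed
  define H where "H = g ` B"
  have finH: "finite H" using finAB by (simp add: H_def)
  have injg: "inj_on g B" by (rule choice_inj_on[OF F(1) ABm(2)]) (use g in auto)
  have cH: "card H = card B" using injg by (simp add: H_def card_image)
  have HE: "H \<subseteq> E" unfolding H_def
  proof (rule image_subsetI)
    fix j assume j: "j \<in> B"
    then have "F j \<subseteq> E" using ABm(2) F(2) by blast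
    with g[OF j] show "g j \<in> E" by simp
  qed
  have HV: "\<forall>e\<in>H. e \<subseteq> V \<and> card e = 2" using HE E by blast
  obtain P where P: "partition_on V P" "\<And>e. e \<in> H \<Longrightarrow> \<exists>C\<in>P. e \<subseteq> C"
    "\<And>C. C \<in> P \<Longrightarrow> C \<times> C \<subseteq> (adj H)\<^sup>*"
    "\<And>C. C \<in> P \<Longrightarrow> card C \<le> Suc (card {e \<in> H. e \<subseteq> C})"
    using component_partition[OF finV finH HV]
    by (elim exE conjE) (rule that, assumption, (erule (1) bspec)+)
  have finP: "finite P" using P(1) finV by (metis finite_elements)
  have Pdisj: "C = D" if "C \<in> P" "D \<in> P" "x \<in> C" "x \<in> D" for C D x
    using that partition_onD2[OF P(1)] by (metis IntI disjointD empty_iff)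
  have closed: "e \<subseteq> C" if "e \<in> H" "C \<in> P" "e \<inter> C \<noteq> {}" for e C
    using P(2)[OF that(1)] Pdisj that by blast

  \<comment> \<open>Otherwise the ends of \<open>e\<close> are joined by a path of \<open>H\<close>
    inside \<open>C\<close>, and adding \<open>e\<close> gives a rainbow cycle of length at most
    \<open>K\<close>.\<close>
  have no_edge: "\<not> e \<subseteq> C" if C: "C \<in> P" "card C \<le> K" and i: "i \<in> A" "e \<in> F i" for C i e
  proof
    assume eC: "e \<subseteq> C"
    have eE: "e \<in> E" using i ABm F(2) by blast
    obtain x y where xy: "e = {x, y}" "x \<noteq> y" using E[OF eE] by (auto simp: card_2_iff)
    \<comment> \<open>As \<open>i\<close> is not in \<open>B\<close>, \<open>?g\<close> chooses one
      edge for each color in \<open>insert i B\<close>. Its injectivity puts \<open>e\<close>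
      outside \<open>H\<close>, and every cycle in \<open>insert e H\<close> is rainbow.\<close>
    let ?g = "g(i := e)"
    have "i \<notin> B" using i(1) disjAB by blast
    then have gB: "?g ` B = H" unfolding H_def by (intro image_cong) auto
    have iB: "insert i B \<subseteq> {1..m}" using i(1) ABm by blast
    have ch: "?g j \<in> F j" if "j \<in> insert i B" for j
      using that g[of j] i(2) by (cases "j = i") auto
    have "inj_on ?g (insert i B)" using choice_inj_on[OF F(1) iB, of ?g] ch by blast
    then have "?g i \<notin> ?g ` B" 
      unfolding inj_on_insert Diff_insert0[OF \<open>i \<notin> B\<close>] Diff_empty by (rule conjunct2)
    then have "{x, y} \<notin> H" unfolding gB using xy(1) by simp
    moreover have "finite C" using C(1) P(1) finV by (metis Sup_upper finite_subset partition_onD1)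
    moreover have "(x, y) \<in> (adj H)\<^sup>*" "x \<in> C" using P(3)[OF C(1)] eC xy by auto
    ultimately have "\<exists>p. is_cycle (insert {x, y} H) p \<and> length p \<le> card C"
      using xy(2) closed C(1) by (intro cycle_in_component) auto
    then obtain p where p: "is_cycle (insert e H) p" "length p \<le> card C"
      unfolding xy(1) by blast
    have "cycle_edges p \<subseteq> ?g ` insert i B"
      using p(1) unfolding is_cycle_def image_insert gB by simp
    then have "rainbow m F (cycle_edges p)"
      using rainbow_choice[OF F(1) iB, of ?g] ch by blast
    moreover have "is_cycle E p" using p(1) is_cycle_mono eE HE by (metis insert_subset)
    ultimately show False using nc p(2) C(2) by fastforce
  qed

  text \<open>The edge count of \<open>H\<close> gives \<open>\<Sum>\<^sub>C (|C| - e(C)) = |A|\<close>, where every summand is at most \<open>1\<close>,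
    with equality exactly for the trees.\<close>
  define P1 where "P1 = {C \<in> P. card C = Suc (card {e \<in> H. e \<subseteq> C})}"
  have cP1: "card A \<le> card P1"
  proof -
    have "H = (\<Union>C\<in>P. {e \<in> H. e \<subseteq> C})" using P(2) by blast
    moreover have "card (\<Union>C\<in>P. {e \<in> H. e \<subseteq> C}) = (\<Sum>C\<in>P. card {e \<in> H. e \<subseteq> C})"
    proof (rule card_UN_disjoint)
      show "\<forall>C\<in>P. \<forall>D\<in>P. C \<noteq> D \<longrightarrow> {e \<in> H. e \<subseteq> C} \<inter> {e \<in> H. e \<subseteq> D} = {}"
      proof (intro ballI impI, rule ccontr)
        fix C D assume CD: "C \<in> P" "D \<in> P" "C \<noteq> D" "{e \<in> H. e \<subseteq> C} \<inter> {e \<in> H. e \<subseteq> D} \<noteq> {}"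
        then obtain e where e: "e \<in> H" "e \<subseteq> C" "e \<subseteq> D" by blast
        then obtain x where "x \<in> e" using HV e(1) by fastforce
        then show False using Pdisj e CD(1-3) by blast
      qed
    qed (use finP finH in auto)
    ultimately have "card B = (\<Sum>C\<in>P. card {e \<in> H. e \<subseteq> C})" using cH by metis
    moreover have "n = sum card P"
      using partition_on_card_Union[OF finV P(1) order_refl] P(1) by (simp add: n_def partition_on_def)
    \<comment> \<open>Outside \<open>P1\<close> the bound on \<open>card C\<close> is strict, so the
      extra unit is charged to trees only.\<close>
    moreover have "sum card P \<le> (\<Sum>C\<in>P. card {e \<in> H. e \<subseteq> C} + (if C \<in> P1 then 1 else 0))"
      using P(4) by (intro sum_mono) (force simp: P1_def)
    moreover have "(\<Sum>C\<in>P. if C \<in> P1 then 1 else 0) = card P1"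
    proof -
      have "P \<inter> P1 = P1" by (auto simp: P1_def)
      then show ?thesis using finP by (simp flip: sum.inter_restrict)
    qed
    ultimately show ?thesis using AB by (simp add: sum.distrib)
  qed

  define L where "L = {C \<in> P1. K < card C}"
  \<comment> \<open>Disjoint parts with more than \<open>K\<close> vertices number at most n / K,
    hence at most \<alpha> n / 2.\<close>
  have cL: "2 * card L \<le> card A"
  proof -
    have "L \<subseteq> P" by (auto simp: L_def P1_def)
    then have "finite L" using finP finite_subset by blast
    have "card L * K = (\<Sum>C\<in>L. K)" by simp
    also have "\<dots> \<le> sum card L" by (intro sum_mono) (auto simp: L_def)
    also have "\<dots> = card (\<Union>L)" using partition_on_card_Union[OF finV P(1) \<open>L \<subseteq> P\<close>] by simp
    also have "\<dots> \<le> n" unfolding n_def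
      using \<open>L \<subseteq> P\<close> finV P(1) by (intro card_mono) (auto simp: partition_on_def)
    finally have "real (card L) * K \<le> n" by (metis of_nat_le_iff of_nat_mult)
    moreover have "real (card L) * (2 / \<alpha>) \<le> real (card L) * K" using K by (intro mult_left_mono) auto
    ultimately have "real (card L) * (2 / \<alpha>) \<le> n" by linarith
    then have "2 * real (card L) \<le> \<alpha> * n" using \<alpha> by (simp add: field_simps)
    with cA show ?thesis by linarith
  qed

  define N where "N i = {C \<in> P. \<Union>(F i) \<inter> C \<noteq> {}}" for i
  have N: "finite (N i) \<and> card (N i) \<le> 3" if "i \<in> A" for i
  proof -
    obtain x y z where "F i = {{x, y}, {y, z}, {x, z}}"
    proof -
      have "is_triangle (F i)" using \<open>i \<in> A\<close> A by (auto simp: triangle_colors_def)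
      then show thesis using that unfolding is_triangle_def by metis
    qed
    then have U: "\<Union>(F i) = {x, y, z}" by auto
    have "card (N i) \<le> card {x, y, z}"
      using card_meeting_parts_le[OF P(1), of "{x, y, z}"] unfolding N_def U by simp
    also have "\<dots> \<le> 3" by (simp add: card_insert_if)
    finally show ?thesis using finP by (simp add: N_def)
  qed
  define P2 where "P2 = {C \<in> P1. card C \<le> K}"
  define M where "M = {C \<in> P2. 12 < card {i \<in> A. C \<in> N i}}"
  define P3 where "P3 = {C \<in> P2. card {i \<in> A. C \<in> N i} \<le> 12}"
  have fin: "finite P1" "finite P2" "finite P3" "finite L" "finite M"
    using finP by (auto simp: P1_def P2_def P3_def L_def M_def)
  \<comment> \<open>Double counting: there are at most 3 |A| incidences of triangles with
    components, and each member of \<open>M\<close> takes at least 13. Since 1/2 + 3/13 < 3/4,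
    discarding \<open>L\<close> and \<open>M\<close> leaves at least |A| / 4 trees.\<close>
  have cM: "13 * card M \<le> 3 * card A"
  proof -
    have "13 * card M = (\<Sum>C\<in>M. 13)" by simp
    also have "\<dots> \<le> (\<Sum>C\<in>M. card {i \<in> A. C \<in> N i})" by (intro sum_mono) (auto simp: M_def)
    also have "\<dots> \<le> (\<Sum>C\<in>P. card {i \<in> A. C \<in> N i})"
      using finP by (intro sum_mono2) (auto simp: M_def P2_def P1_def)
    also have "\<dots> = (\<Sum>i\<in>A. card {C \<in> P. C \<in> N i})"
      using finP finAB by (intro sum_multicount_gen) auto
    also have "\<dots> \<le> (\<Sum>i\<in>A. 3)"
    proof (rule sum_mono)
      fix i assume "i \<in> A"
      moreover have "{C \<in> P. C \<in> N i} = N i" by (auto simp: N_def)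
      ultimately show "card {C \<in> P. C \<in> N i} \<le> 3" using N by simp
    qed
    finally show ?thesis by simp
  qed
  have "P1 = L \<union> P2" "P2 = M \<union> P3" by (auto simp: L_def P2_def M_def P3_def)
  then have "card P1 \<le> card L + card P2" "card P2 \<le> card M + card P3"
    by (metis card_Un_le)+
  then have cP3: "card A \<le> 4 * card P3" using cP1 cL cM by linarith
  \<comment> \<open>Here 37 = 1 + 12 * 3.\<close>
  obtain S where S: "S \<subseteq> P3" "\<And>i. i \<in> A \<Longrightarrow> card (N i \<inter> S) \<le> 1" "card P3 \<le> 37 * card S"
    using independent_family[OF fin(3) finAB(1), of N 3 12] N by (auto simp: P3_def)
  have SP: "S \<subseteq> P" using S(1) by (auto simp: P1_def P2_def P3_def)
  have finS: "finite S" using S(1) fin finite_subset by blast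
  define U where "U = \<Union>S"
  have UV: "U \<subseteq> V" using SP P(1) by (auto simp: U_def partition_on_def)

  \<comment> \<open>Two vertices of the triangle in \<open>U\<close> would lie in the same tree of
    \<open>S\<close>, which \<open>no_edge\<close> forbids. So at most one vertex is deleted and the
    opposite edge survives.\<close>
  have "\<exists>e\<in>F i. e \<inter> U = {}" if i: "i \<in> A" for i
  proof -
    obtain x y z where t: "F i = {{x, y}, {y, z}, {x, z}}"
    proof -
      have "is_triangle (F i)" using \<open>i \<in> A\<close> A by (auto simp: triangle_colors_def)
      then show thesis using that unfolding is_triangle_def by metis
    qed
    have noU: False if "a \<in> U" "b \<in> U" "{a, b} \<in> F i" for a b
    proof -
      obtain C D where CD: "C \<in> S" "a \<in> C" "D \<in> S" "b \<in> D"
        using \<open>a \<in> U\<close> \<open>b \<in> U\<close> by (auto simp: U_def)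
      then have "{C, D} \<subseteq> N i \<inter> S" using that(3) SP by (auto simp: N_def)
      moreover have "finite (N i \<inter> S)" using finS by simp
      ultimately have "C = D" using S(2)[OF i]
        by (metis card_le_Suc0_iff_eq insert_subset One_nat_def)
      moreover have "card C \<le> K" using CD(1) S(1) by (auto simp: P3_def P2_def)
      ultimately show False using no_edge[of C i "{a, b}"] CD SP i that(3) by blast
    qed
    show ?thesis
      using noU[of x y] noU[of y z] noU[of x z] t by (cases "x \<in> U"; cases "y \<in> U") auto
  qed
  then obtain f where f: "\<And>i. i \<in> A \<Longrightarrow> f i \<in> F i \<and> f i \<inter> U = {}" by metis
  define h where "h j = (if j \<in> A then f j else g j)" for j
  define B' where "B' = {j \<in> B. g j \<inter> U = {}}"
  define E' where "E' = h ` (A \<union> B')"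
  have ch: "h j \<in> F j \<and> h j \<inter> U = {}" if "j \<in> A \<union> B'" for j
    using that f g by (auto simp: h_def B'_def)
  have ABm': "A \<union> B' \<subseteq> {1..m}" using ABm by (auto simp: B'_def)
  have "card E' = card (A \<union> B')"
    unfolding E'_def using choice_inj_on[OF F(1) ABm', of h] ch by (intro card_image) blast
  also have "\<dots> = card A + card B'"
    using disjAB finAB by (intro card_Un_disjoint) (auto simp: B'_def)
  finally have cE': "card E' = card A + card B'" .
  \<comment> \<open>Edges of \<open>H\<close> meeting \<open>U\<close> lie inside deleted trees, and
    a tree \<open>C\<close> has \<open>card C - 1\<close> of them. The second conjunct keeps the
    natural subtraction from truncating.\<close>
  have "card B \<le> card B' + (card U - card S) \<and> card S \<le> card U"
  proof -
    have "H \<subseteq> g ` B' \<union> (\<Union>C\<in>S. {e \<in> H. e \<subseteq> C})"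
    proof
      fix e assume e: "e \<in> H"
      show "e \<in> g ` B' \<union> (\<Union>C\<in>S. {e \<in> H. e \<subseteq> C})"
      proof (cases "e \<inter> U = {}")
        case True
        then show ?thesis using e by (auto simp: H_def B'_def)
      next
        case False
        then obtain C where "C \<in> S" "e \<inter> C \<noteq> {}" unfolding U_def by blast
        then show ?thesis using closed[OF e] SP e by blast
      qed
    qed
    then have "card H \<le> card (g ` B' \<union> (\<Union>C\<in>S. {e \<in> H. e \<subseteq> C}))"
      using finAB finS finH by (intro card_mono) (auto simp: B'_def)
    also have "\<dots> \<le> card (g ` B') + card (\<Union>C\<in>S. {e \<in> H. e \<subseteq> C})" by (rule card_Un_le)
    also have "\<dots> \<le> card B' + (\<Sum>C\<in>S. card {e \<in> H. e \<subseteq> C})"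
      using finAB finS by (intro add_mono card_image_le card_UN_le) (auto simp: B'_def)
    finally have "card B \<le> card B' + (\<Sum>C\<in>S. card {e \<in> H. e \<subseteq> C})" using cH by simp
    moreover have "card U = (\<Sum>C\<in>S. card {e \<in> H. e \<subseteq> C}) + card S"
    proof -
      have "card U = sum card S" unfolding U_def by (rule partition_on_card_Union[OF finV P(1) SP])
      also have "\<dots> = (\<Sum>C\<in>S. card {e \<in> H. e \<subseteq> C} + 1)"
        using S(1) by (intro sum.cong) (auto simp: P3_def P2_def P1_def)
      also have "\<dots> = (\<Sum>C\<in>S. card {e \<in> H. e \<subseteq> C}) + card S"
        unfolding sum.distrib by simp
      finally show ?thesis .
    qed
    ultimately show ?thesis by simp
  qed
  moreover have cVU: "card (V - U) = n - card U" "card U \<le> n"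
    using UV finV by (auto simp: n_def card_Diff_subset finite_subset card_mono)
  ultimately have "card (V - U) + card S \<le> card E'" using cE' AB by linarith
  then have "real (card (V - U)) + card S \<le> card E'" by linarith
  moreover have "\<alpha> / 148 * card (V - U) \<le> card S"
  proof -
    have "\<alpha> * card (V - U) \<le> \<alpha> * n" using cVU \<alpha> by (intro mult_left_mono) auto
    then show ?thesis using cA cP3 S(3) by linarith
  qed
  ultimately have dense: "(1 + \<alpha> / 148) * card (V - U) \<le> card E'" by (simp add: algebra_simps)
  have E'E: "E' \<subseteq> E" unfolding E'_def
  proof (rule image_subsetI)
    fix j assume j: "j \<in> A \<union> B'"
    then have "F j \<subseteq> E" using ABm' F(2) by blast
    then show "h j \<in> E" using ch[OF j] by blast
  qed
  have E'U: "e \<inter> U = {}" if "e \<in> E'" for e using that ch unfolding E'_def by blast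
  \<comment> \<open>Some triangle color exists; its surviving edge shows that \<open>V - U\<close>
    is nonempty.\<close>
  have "0 < \<alpha> * n" using \<alpha> n0 by simp
  with cA have "A \<noteq> {}" by auto
  then obtain i where i: "i \<in> A" by blast
  have "\<exists>p. is_cycle E' p \<and> length p \<le> 2 * R"
  proof (rule dense_short_cycle[OF _ _ _ dense])
    show "e \<subseteq> V - U \<and> card e = 2" if "e \<in> E'" for e
      using E[of e] E'U[OF that] E'E that by blast
    then have "h i \<subseteq> V - U \<and> card (h i) = 2" using i by (simp add: E'_def)
    then show "V - U \<noteq> {}" by force
    show "real (card (V - U)) < (1 + \<alpha> / 148) ^ R" using R cVU by (simp add: n_def)
  qed (use finV \<alpha> in auto)
  then obtain p where p: "is_cycle E' p" "length p \<le> 2 * R" by blast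
  have "rainbow m F (cycle_edges p)"
    using rainbow_choice[OF F(1) ABm', of h] ch p(1) unfolding is_cycle_def E'_def by blast
  with nc is_cycle_mono[OF p(1) E'E] p(2) show False by fastforce
qed

section \<open>Choice of the constant and the logarithmic bound\<close>

theorem theorem12:
  "\<forall>\<alpha>::real. \<alpha> > 0 \<longrightarrow>
     (\<exists>C::real. C > 0 \<and>
       (\<forall>(n::nat) (V :: 'a set) E m F.
          n > 0 \<longrightarrow> simple_graph V E \<longrightarrow> card V = n \<longrightarrow> edge_coloring E m F \<longrightarrow>
          real (card (triangle_colors m F)) \<ge> \<alpha> * real n \<longrightarrow>
          real (card (single_edge_colors m F)) \<ge> (1 - \<alpha>) * real n \<longrightarrow>
          ereal_of_enat (rgirth E m F) \<le> ereal (C * ln (real n))))"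
proof (intro allI impI)
  fix \<alpha> :: real assume \<alpha>: "\<alpha> > 0"
  \<comment> \<open>Capping at 1 makes the previous result applicable when \<alpha> > 1. The total
    of at least \<open>n\<close> colors still comes from the original \<alpha>, by adding the two
    hypotheses.\<close>
  define \<beta> where "\<beta> = min \<alpha> 1"
  have \<beta>: "0 < \<beta>" "\<beta> \<le> 1" "\<beta> \<le> \<alpha>" using \<alpha> by (auto simp: \<beta>_def)
  define K where "K = nat \<lceil>2 / \<beta>\<rceil>"
  define c where "c = ln (1 + \<beta> / 148)"
  have c: "c > 0" using \<beta> by (simp add: c_def)
  define C where "C = real K + (2 / c + 2)"
  have K: "2 / \<beta> \<le> K" unfolding K_def by linarith
  have C: "C > 0" unfolding C_def using c by (simp add: add_nonneg_pos add_pos_pos)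
  have "ereal_of_enat (rgirth E m F) \<le> ereal (C * ln (real n))"
    if n: "n > 0" and V: "simple_graph V E" "card V = n" and col: "edge_coloring E m F"
      and tri: "real (card (triangle_colors m F)) \<ge> \<alpha> * real n"
      and sing: "real (card (single_edge_colors m F)) \<ge> (1 - \<alpha>) * real n"
    for n m :: nat and V :: "'a set" and E F
  proof -
    \<comment> \<open>The least natural number strictly above ln n / c, so that the power exceeds
      \<open>n\<close> strictly.\<close>
    define R where "R = Suc (nat \<lfloor>ln n / c\<rfloor>)"
    have ln0: "ln n \<ge> 0" using n by simp
    have Rl: "ln n / c < R" and Ru: "real R \<le> ln n / c + 1"
      unfolding R_def using ln0 c by (auto simp: nat_less_real_le) linarith+
    have "ln (real n) < real R * c" using Rl c by (simp add: field_simps)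
    also have "\<dots> = ln ((1 + \<beta> / 148) ^ R)" using \<beta> by (simp add: c_def ln_realpow)
    finally have "real n < (1 + \<beta> / 148) ^ R" using n \<beta> by (subst (asm) ln_less_cancel_iff) auto
    moreover have "V \<noteq> {}" using V(2) n by auto
    moreover have "\<beta> * card V \<le> card (triangle_colors m F)"
      using tri V(2) mult_right_mono[OF \<beta>(3), of n] by simp
    moreover have "card V \<le> card (triangle_colors m F) + card (single_edge_colors m F)"
      using tri sing V(2) by (simp add: algebra_simps flip: of_nat_add of_nat_le_iff)
    ultimately obtain p where p: "is_cycle E p" "rainbow m F (cycle_edges p)"
      "length p \<le> max K (2 * R)"
      using rainbow_short_cycle[OF \<beta>(1,2) V(1) _ col _ _ K] V(2) by metis
    \<comment> \<open>The cycle found has at least three distinct vertices in \<open>V\<close>.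
      Hence n \<ge> 3 \<ge> e and ln n \<ge> 1, so the additive constant \<open>K + 2\<close> is
      absorbed into \<open>C * ln n\<close>.\<close>
    have "n \<ge> 3"
    proof -
      have "set p \<subseteq> V"
      proof
        fix x assume "x \<in> set p"
        then obtain i where "i < length p" "x = p ! i" by (auto simp: in_set_conv_nth)
        then have "\<exists>e\<in>cycle_edges p. x \<in> e" by (auto simp: cycle_edges_def)
        then show "x \<in> V" using p(1) V(1) by (auto simp: is_cycle_def simple_graph_def)
      qed
      then have "length p \<le> n"
        using p(1) V by (metis card_mono distinct_card is_cycle_def simple_graph_def)
      then show ?thesis using p(1) by (simp add: is_cycle_def)
    qed
    then have "exp 1 \<le> real n" using exp_le by linarith
    then have ln1: "1 \<le> ln (real n)" using n by (simp add: ln_ge_iff)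
    have "real (length p) \<le> real K + 2 * real R" using p(3) by linarith
    also have "\<dots> \<le> K + 2 * (ln n / c + 1)" using Ru by simp
    also have "\<dots> \<le> C * ln n"
      using mult_left_mono[OF ln1, of "real K + 2"] by (simp add: C_def algebra_simps)
    finally have len: "real (length p) \<le> C * ln n" .
    have "rgirth E m F \<le> enat (length p)" unfolding rgirth_def using p by (intro INF_lower) auto
    then have "ereal_of_enat (rgirth E m F) \<le> ereal_of_enat (enat (length p))"
      by (simp only: ereal_of_enat_le_iff)
    also have "\<dots> \<le> ereal (C * ln n)" using len by simp
    finally show ?thesis .
  qed
  with C show "\<exists>C>0. \<forall>(n::nat) (V :: 'a set) E m F.
          n > 0 \<longrightarrow> simple_graph V E \<longrightarrow> card V = n \<longrightarrow> edge_coloring E m F \<longrightarrow>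
          real (card (triangle_colors m F)) \<ge> \<alpha> * real n \<longrightarrow>
          real (card (single_edge_colors m F)) \<ge> (1 - \<alpha>) * real n \<longrightarrow>
          ereal_of_enat (rgirth E m F) \<le> ereal (C * ln (real n))" by blast
qed

end
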